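(* Let $B_{\sigma,\mathrm{bc}}$ and $B'_{\sigma,\mathrm{bc}}$ be two matrix representatives of the same boundary-compatible singular sector $\sigma$ satisfying $$B'_{\sigma,\mathrm{bc}}=R\,B_{\sigma,\mathrm{bc}}\,S,$$ where $R$ and $S$ are diagonal matrices with diagonal entries in $\{\pm1\}$. Then $$\{A^{\circ2}:A\in\ker B'_{\sigma,\mathrm{bc}}\}=\{A^{\circ2}:A\in\ker B_{\sigma,\mathrm{bc}}\}.$$ Consequently the singular-completion cone $\mathcal M_G^{\mathrm{bc}}$, its normalized slice $\{r\in\mathcal M_G^{\mathrm{bc}}:\ell\cdot r=1\}$, the sector Rayleigh quotient infimum $\inf_{0\ne A\in\ker B_{\sigma,\mathrm{bc}}}\frac{A^*W_\alpha A}{A^*D_\ell A}$, and the dual positivity condition "$A^*D_dA\ge0$ for all $A\in\ker B_{\sigma,\mathrm{bc}}$" ($d\in\mathbb R^E$) are unchanged when representatives are replaced by switched representatives.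
   Context: Let $G=(V,E)$ be a finite metric graph (loops and multiple edges allowed) with edge lengths $\ell_e>0$, whose vertices are split into internal vertices $V_{\mathrm{int}}$ (standard Kirchhoff conditions) and degree-one exterior vertices, each carrying a Dirichlet or a Neumann condition; every edge has at least one internal endpoint, so edges are internal--internal, internal--Dirichlet or internal--Neumann. Orient the edges, terminal edges from the internal to the exterior endpoint. A boundary-compatible singular sector $\sigma$ consists of: a parity $\sigma_e=\cos\theta_e\in\{\pm1\}$, $\theta_e\in\pi\mathbb Z$, for each internal--internal edge; a phase class $\theta_e\in\pi\mathbb Z$ for each internal--Dirichlet edge; a phase class $\theta_e\in\frac\pi2+\pi\mathbb Z$ for each internal--Neumann edge. The matrix $B_{\sigma,\mathrm{bc}}\in\mathbb R^{V_{\mathrm{int}}\times E}$ has: for a non-loop internal--internal edge from $v_-$ to $v_+$, entries $1$ in row $v_-$ and $-\sigma_e$ in row $v_+$; for a loop at $v$, entry $1-\sigma_e$ in row $v$; for a terminal edge at internal vertex $v$, entry $1$ in row $v$; all other entries zero. Other representatives arise from changes of edge orientation, of amplitude sign, or of the sign used to write a Kirchhoff equation. For $A\in\mathbb R^E$, $A^{\circ2}=(A_e^2)_{e\in E}$. $\mathcal M_G^{\mathrm{bc}}$ is the convex cone generated by $\bigcup_\sigma\{A^{\circ2}:A\in\ker B_{\sigma,\mathrm{bc}}\}$. $D_\ell=\operatorname{diag}(\ell_e)$, $W_\alpha=\operatorname{diag}(\alpha_e)$ with $\alpha_e\ge0$, $D_d=\operatorname{diag}(d_e)$. *)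

theory Defs
  imports "HOL-Analysis.Analysis"
begin

section \<open>Metric graphs with Dirichlet and Neumann exterior vertices\<close>

text \<open>
  The internal vertices are the elements of a finite type \<open>'i\<close> and the edges those of a finite
  type \<open>'e\<close>, so that the matrices below are library matrices with rows indexed by the internal
  vertices and columns by the edges. The exterior vertices form a (possibly empty) set
  of elements of a type \<open>'x\<close>.
\<close>

datatype ('i, 'x) vertex = Internal 'i | Exterior 'x

datatype boundary_condition = Dirichlet | Neumann

record ('i, 'x, 'e::finite) metric_graph =
  exterior_set :: "'x set"
  condition_at :: "'x \<Rightarrow> boundary_condition"
  tail :: "'e \<Rightarrow> ('i, 'x) vertex"
  head :: "'e \<Rightarrow> ('i, 'x) vertex"
  edge_length :: "real ^ 'e"

text \<open>A loop counts twice.\<close>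

definition degree :: "('i, 'x, 'e::finite) metric_graph \<Rightarrow> ('i, 'x) vertex \<Rightarrow> nat" where
  "degree G v = card {e. tail G e = v} + card {e. head G e = v}"

text \<open>
  That every edge has an internal endpoint and that terminal edges are oriented from the internal
  to the exterior endpoint amounts to every tail being internal.
\<close>

definition wf_metric_graph :: "('i, 'x, 'e::finite) metric_graph \<Rightarrow> bool" where
  "wf_metric_graph G \<longleftrightarrow>
     (\<forall>e. 0 < edge_length G $ e) \<and>
     (\<forall>e. tail G e \<in> range Internal) \<and>
     (\<forall>e. head G e \<in> range Internal \<union> Exterior ` exterior_set G) \<and>
     (\<forall>x \<in> exterior_set G. degree G (Exterior x) = 1)"

definition internal_edge :: "('i, 'x, 'e::finite) metric_graph \<Rightarrow> 'e \<Rightarrow> bool" where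
  "internal_edge G e \<longleftrightarrow> tail G e \<in> range Internal \<and> head G e \<in> range Internal"

definition terminal_edge ::
    "('i, 'x, 'e::finite) metric_graph \<Rightarrow> boundary_condition \<Rightarrow> 'e \<Rightarrow> bool" where
  "terminal_edge G c e \<longleftrightarrow> (\<exists>x \<in> exterior_set G. head G e = Exterior x \<and> condition_at G x = c)"

definition reverse_edges ::
    "'e set \<Rightarrow> ('i, 'x, 'e::finite) metric_graph \<Rightarrow> ('i, 'x, 'e::finite) metric_graph" where
  "reverse_edges F G = G
     \<lparr> tail := (\<lambda>e. if e \<in> F then head G e else tail G e),
       head := (\<lambda>e. if e \<in> F then tail G e else head G e) \<rparr>"


section \<open>Singular sectors and their matrices\<close>

text \<open>
  A boundary-compatible singular sector is given by a phase \<open>\<theta> e\<close> for every edge; on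
  internal--internal edges only the parity \<open>cos (\<theta> e)\<close> matters. Different phase functions with the
  same parities and phase classes describe the same sector; all notions below depend on the phases
  only through the parities of the internal--internal edges.
\<close>

definition singular_sectors :: "('i, 'x, 'e::finite) metric_graph \<Rightarrow> ('e \<Rightarrow> real) set" where
  "singular_sectors G = {\<theta>. \<forall>e.
     (internal_edge G e \<longrightarrow> (\<exists>k::int. \<theta> e = of_int k * pi)) \<and>
     (terminal_edge G Dirichlet e \<longrightarrow> (\<exists>k::int. \<theta> e = of_int k * pi)) \<and>
     (terminal_edge G Neumann e \<longrightarrow> (\<exists>k::int. \<theta> e = pi / 2 + of_int k * pi))}"

definition parity :: "('e \<Rightarrow> real) \<Rightarrow> 'e \<Rightarrow> real" where
  "parity \<theta> e = cos (\<theta> e)"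

definition sector_matrix ::
    "('i::finite, 'x, 'e::finite) metric_graph \<Rightarrow> ('e \<Rightarrow> real) \<Rightarrow> real ^ 'e ^ 'i" where
  "sector_matrix G \<theta> = (\<chi> v e.
     if \<not> internal_edge G e then (if tail G e = Internal v then 1 else 0)
     else if tail G e = head G e then (if tail G e = Internal v then 1 - parity \<theta> e else 0)
     else if tail G e = Internal v then 1
     else if head G e = Internal v then - parity \<theta> e
     else 0)"

text \<open>
  The matrix representatives of a sector: only internal--internal edges can be reversed, as the
  orientation of terminal edges is fixed by convention.
\<close>

inductive sector_representative ::
    "('i::finite, 'x, 'e::finite) metric_graph \<Rightarrow> ('e \<Rightarrow> real) \<Rightarrow> real ^ 'e ^ 'i \<Rightarrow> bool"
  for G \<theta> where
  orientation: "(\<And>e. e \<in> F \<Longrightarrow> internal_edge G e) \<Longrightarrow>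
    sector_representative G \<theta> (sector_matrix (reverse_edges F G) \<theta>)"
| amplitude_sign: "sector_representative G \<theta> B \<Longrightarrow>
    sector_representative G \<theta> (\<chi> v f. if f = e then - B $ v $ f else B $ v $ f)"
| kirchhoff_sign: "sector_representative G \<theta> B \<Longrightarrow>
    sector_representative G \<theta> (\<chi> u e. if u = v then - B $ u $ e else B $ u $ e)"

lemma sector_representative_sector_matrix: "sector_representative G \<theta> (sector_matrix G \<theta>)"
  using sector_representative.orientation[of "{}" G \<theta>] by (simp add: reverse_edges_def)

definition diag :: "real ^ 'n \<Rightarrow> real ^ 'n ^ 'n" where
  "diag d = (\<chi> i j. if i = j then d $ i else 0)"

definition sign_diagonal :: "real ^ 'n ^ 'n \<Rightarrow> bool" where
  "sign_diagonal R \<longleftrightarrow> (\<exists>r. (\<forall>i. r $ i \<in> {1, -1}) \<and> R = diag r)"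

definition switched :: "real ^ 'e::finite ^ 'i::finite \<Rightarrow> real ^ 'e ^ 'i \<Rightarrow> bool" where
  "switched B B' \<longleftrightarrow>
     (\<exists>(R :: real ^ 'i ^ 'i) (S :: real ^ 'e ^ 'e).
        sign_diagonal R \<and> sign_diagonal S \<and> B' = R ** B ** S)"


section \<open>The objects computed from representatives\<close>

definition matrix_kernel :: "real ^ 'e::finite ^ 'i::finite \<Rightarrow> (real ^ 'e) set" where
  "matrix_kernel B = {A. B *v A = 0}"

definition entrywise_square :: "real ^ 'e \<Rightarrow> real ^ 'e" where
  "entrywise_square A = (\<chi> e. (A $ e)\<^sup>2)"

definition quad_form :: "real ^ 'e::finite ^ 'e \<Rightarrow> real ^ 'e \<Rightarrow> real" where
  "quad_form M A = A \<bullet> (M *v A)"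

text \<open>
  The cone computed from a choice \<open>B\<close> of a matrix for every sector; the singular-completion
  cone itself is the one obtained from the standard matrices \<^const>\<open>sector_matrix\<close>.
\<close>

definition completion_cone_of ::
    "('i::finite, 'x, 'e::finite) metric_graph \<Rightarrow> (('e \<Rightarrow> real) \<Rightarrow> real ^ 'e ^ 'i) \<Rightarrow> (real ^ 'e) set"
where
  "completion_cone_of G B =
     convex_cone hull (\<Union>\<theta> \<in> singular_sectors G. entrywise_square ` matrix_kernel (B \<theta>))"

definition singular_completion_cone ::
    "('i::finite, 'x, 'e::finite) metric_graph \<Rightarrow> (real ^ 'e) set" where
  "singular_completion_cone G = completion_cone_of G (sector_matrix G)"

definition normalized_slice ::
    "('i, 'x, 'e::finite) metric_graph \<Rightarrow> (real ^ 'e) set \<Rightarrow> (real ^ 'e) set" where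
  "normalized_slice G M = {r \<in> M. edge_length G \<bullet> r = 1}"

text \<open>Extended-real valued: the infimum is \<open>\<infinity>\<close> if the kernel is trivial.\<close>

definition rayleigh_infimum ::
    "('i, 'x, 'e::finite) metric_graph \<Rightarrow> real ^ 'e \<Rightarrow> real ^ 'e::finite ^ 'i::finite \<Rightarrow> ereal" where
  "rayleigh_infimum G \<alpha> B =
     (INF A \<in> matrix_kernel B - {0}.
        ereal (quad_form (diag \<alpha>) A / quad_form (diag (edge_length G)) A))"

definition dual_positive :: "real ^ 'e \<Rightarrow> real ^ 'e::finite ^ 'i::finite \<Rightarrow> bool" where
  "dual_positive d B \<longleftrightarrow> (\<forall>A \<in> matrix_kernel B. 0 \<le> quad_form (diag d) A)"

end

theory Submission
  imports Defs
begin

text \<open>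
  Two observations carry the proof. First, if \<open>B' = R B S\<close> with sign matrices \<open>R\<close> and \<open>S\<close>, then
  \<open>R\<close> is invertible and so does not affect the kernel, while \<open>S\<^sup>2 = 1\<close>; hence \<open>A \<mapsto> S A\<close> exchanges
  \<open>ker B'\<close> and \<open>ker B\<close>. This map only changes signs of entries, so it is invisible after squaring
  (\<open>squared_kernel_switched\<close>). Second, a diagonal quadratic form is linear in the squared vector,
  \<open>A\<^sup>* D\<^sub>d A = d \<bullet> A\<^sup>\<circ>\<^sup>2\<close>, and \<open>A\<close> vanishes exactly when its square does. Hence the Rayleigh
  infimum and dual positivity, like the cone and its slice by construction, see the kernel only
  through the set of its squared vectors.
\<close>

lemma diag_mult_vec_nth [simp]: "(diag d *v A) $ i = d $ i * A $ i"
  for d A :: "real ^ 'n::finite"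
  by (simp add: diag_def matrix_vector_mult_def if_distrib if_distribR cong: if_cong)

lemma sign_diagonal_involution:
  fixes S :: "real ^ 'n::finite ^ 'n"
  assumes "sign_diagonal S"
  shows "S *v (S *v A) = A"
proof -
  obtain s where s: "\<And>i. s $ i \<in> {1, -1}" and S: "S = diag s"
    using assms by (auto simp: sign_diagonal_def)
  have "s $ i * (s $ i * A $ i) = A $ i" for i
    using s[of i] by auto
  then show ?thesis by (simp add: S vec_eq_iff)
qed

lemma entrywise_square_sign_diagonal:
  fixes S :: "real ^ 'n::finite ^ 'n"
  assumes "sign_diagonal S"
  shows "entrywise_square (S *v A) = entrywise_square A"
proof -
  obtain s where s: "\<And>i. s $ i \<in> {1, -1}" and S: "S = diag s"
    using assms by (auto simp: sign_diagonal_def)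
  have "(s $ i * A $ i)\<^sup>2 = (A $ i)\<^sup>2" for i
    using s[of i] by auto
  then show ?thesis by (simp add: S entrywise_square_def)
qed

text \<open>
  Since \<open>R\<close> and \<open>S\<close> are involutions, \<open>R B S A = 0\<close> iff \<open>B (S A) = 0\<close>, and every vector is
  \<open>S\<close> applied to its own image under \<open>S\<close>.
\<close>

lemma matrix_kernel_sign_diagonal:
  fixes B :: "real ^ 'e::finite ^ 'i::finite"
  assumes "sign_diagonal R" "sign_diagonal S"
  shows "matrix_kernel (R ** B ** S) = (*v) S ` matrix_kernel B"
proof -
  have R: "R *v w = 0 \<longleftrightarrow> w = 0" for w
    using sign_diagonal_involution[OF assms(1)] by (metis matrix_vector_mult_0_right)
  have "A \<in> matrix_kernel (R ** B ** S) \<longleftrightarrow> S *v A \<in> matrix_kernel B" for A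
    by (simp add: matrix_kernel_def R flip: matrix_vector_mul_assoc)
  then show ?thesis
    using sign_diagonal_involution[OF assms(2)] by (auto simp: image_iff) metis
qed

lemma squared_kernel_switched:
  assumes "switched B B'"
  shows "entrywise_square ` matrix_kernel B' = entrywise_square ` matrix_kernel B"
proof -
  obtain R S where "sign_diagonal R" and S: "sign_diagonal S" and "B' = R ** B ** S"
    using assms by (auto simp: switched_def)
  then have "matrix_kernel B' = (*v) S ` matrix_kernel B"
    by (simp add: matrix_kernel_sign_diagonal)
  then show ?thesis
    by (simp add: image_image entrywise_square_sign_diagonal[OF S])
qed

lemma quad_form_diag: "quad_form (diag d) A = d \<bullet> entrywise_square A"
  by (simp add: quad_form_def inner_vec_def entrywise_square_def power2_eq_square mult_ac)

lemma entrywise_square_eq_0_iff: "entrywise_square A = 0 \<longleftrightarrow> A = 0"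
  by (simp add: entrywise_square_def vec_eq_iff)

text \<open>
  The infimum is over a linear-fractional function of the squared vector; the excluded zero vector
  of the kernel corresponds exactly to the zero square.
\<close>

lemma rayleigh_infimum_squared_kernel:
  "rayleigh_infimum G \<alpha> B =
     (INF r \<in> entrywise_square ` matrix_kernel B - {0}. ereal (\<alpha> \<bullet> r / (edge_length G \<bullet> r)))"
proof -
  have "entrywise_square ` matrix_kernel B - {0} = entrywise_square ` (matrix_kernel B - {0})"
    using entrywise_square_eq_0_iff by auto
  then show ?thesis
    by (simp add: rayleigh_infimum_def quad_form_diag image_image)
qed

lemma dual_positive_squared_kernel:
  "dual_positive d B \<longleftrightarrow> (\<forall>r \<in> entrywise_square ` matrix_kernel B. 0 \<le> d \<bullet> r)"
  by (simp add: dual_positive_def quad_form_diag)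

lemma completion_cone_of_switched:
  assumes "\<And>\<theta>. \<theta> \<in> singular_sectors G \<Longrightarrow> switched (B \<theta>) (B' \<theta>)"
  shows "completion_cone_of G B' = completion_cone_of G B"
  by (simp add: completion_cone_of_def squared_kernel_switched[OF assms])

theorem proposition4p4:
  fixes G :: "('i::finite, 'x, 'e::finite) metric_graph"
  assumes "wf_metric_graph G"
  shows
    "(\<forall>\<theta> \<in> singular_sectors G. \<forall>B B'.
        sector_representative G \<theta> B \<longrightarrow> sector_representative G \<theta> B' \<longrightarrow> switched B B' \<longrightarrow>
          entrywise_square ` matrix_kernel B' = entrywise_square ` matrix_kernel B \<and>
          (\<forall>\<alpha>. (\<forall>e. 0 \<le> \<alpha> $ e) \<longrightarrow> rayleigh_infimum G \<alpha> B' = rayleigh_infimum G \<alpha> B) \<and>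
          (\<forall>d. dual_positive d B' \<longleftrightarrow> dual_positive d B)) \<and>
     (\<forall>B B'.
        (\<forall>\<theta> \<in> singular_sectors G. sector_representative G \<theta> (B \<theta>) \<and>
            sector_representative G \<theta> (B' \<theta>) \<and> switched (B \<theta>) (B' \<theta>)) \<longrightarrow>
          completion_cone_of G B' = completion_cone_of G B \<and>
          normalized_slice G (completion_cone_of G B') =
            normalized_slice G (completion_cone_of G B)) \<and>
     (\<forall>B'.
        (\<forall>\<theta> \<in> singular_sectors G.
            sector_representative G \<theta> (B' \<theta>) \<and> switched (sector_matrix G \<theta>) (B' \<theta>)) \<longrightarrow>
          completion_cone_of G B' = singular_completion_cone G \<and>
          normalized_slice G (completion_cone_of G B') =
            normalized_slice G (singular_completion_cone G))"
proof -
  have cone: "completion_cone_of G B' = completion_cone_of G B \<and>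
      normalized_slice G (completion_cone_of G B') = normalized_slice G (completion_cone_of G B)"
    if "\<forall>\<theta> \<in> singular_sectors G. switched (B \<theta>) (B' \<theta>)" for B B'
    using completion_cone_of_switched[of G B B'] that by simp
  show ?thesis
    unfolding singular_completion_cone_def rayleigh_infimum_squared_kernel
      dual_positive_squared_kernel
    by (intro conjI[OF _ conjI] allI ballI impI)
      ((simp only: squared_kernel_switched)+, (rule cone; blast)+)
qed

end
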